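(* Let $\Omega\subset\mathbb{R}^n$ be compact and convex, and let $\dot x=f(x)$ be a time-invariant system evolving on $\Omega$. If the system is interior contractive (IC) on $\Omega$, then it is a contraction after a short transient (ST) on $\Omega$; that is, there is a norm $|\cdot|:\mathbb{R}^n\to\mathbb{R}_+$ such that for each $\tau>0$ there exists $\ell=\ell(\tau)>0$ with $$|x(t_2+\tau,t_1,a)-x(t_2+\tau,t_1,b)|\le \exp(-(t_2-t_1)\ell)\,|a-b|$$ for all $t_2\ge t_1\ge 0$ and all $a,b\in\Omega$.
   Context: Standing assumptions: $f:\Omega\to\mathbb{R}^n$ is differentiable, and $f$ and its Jacobian $J(x):=\frac{\partial f}{\partial x}(x)$ are continuous on $\Omega$. For every $t_0\ge 0$ and $x_0\in\Omega$ the solution $x(t,t_0,x_0)$ with $x(t_0)=x_0$ exists, is unique, and stays in $\Omega$ for all $t\ge t_0$. For this time-invariant system, $x(t,x_0):=x(t,0,x_0)$, so $x(t,t_0,x_0)=x(t-t_0,x_0)$. Matrix measure: a vector norm $|\cdot|:\mathbb{R}^n\to\mathbb{R}_+$ with induced matrix norm $\|\cdot\|$ induces the matrix measure $\mu:\mathbb{R}^{n\times n}\to\mathbb{R}$, $\mu(A):=\lim_{\epsilon\downarrow 0}\frac1\epsilon(\|I+\epsilon A\|-1)$. Interior contractive (IC): the time-invariant system $\dot x=f(x)$ evolving on the compact and convex set $\Omega$ is IC if (a) for every $x_0\in\partial\Omega$, $x(t,x_0)\notin\partial\Omega$ for all $t>0$; and (b) there exists a matrix measure $\mu:\mathbb{R}^{n\times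 n}\to\mathbb{R}$ (induced by some vector norm) such that $\mu(J(x))<0$ for all $x\in\mathrm{Int}(\Omega)$. Here $\mathrm{Int}(\Omega)$ and $\partial\Omega$ are the interior and boundary of $\Omega$ in $\mathbb{R}^n$. *)

theory Defs
  imports "HOL-Analysis.Analysis"
begin

definition vector_norm :: "(real^'n \<Rightarrow> real) \<Rightarrow> bool" where
  "vector_norm N \<longleftrightarrow>
     (\<forall>x. 0 \<le> N x) \<and> (\<forall>x. N x = 0 \<longleftrightarrow> x = 0) \<and>
     (\<forall>c x. N (c *\<^sub>R x) = \<bar>c\<bar> * N x) \<and>
     (\<forall>x y. N (x + y) \<le> N x + N y)"

definition induced_norm :: "(real^'n \<Rightarrow> real) \<Rightarrow> real^'n^'n \<Rightarrow> real" where
  "induced_norm N A = (SUP x\<in>{x. N x = 1}. N (A *v x))"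

definition matrix_measure :: "(real^'n \<Rightarrow> real) \<Rightarrow> real^'n^'n \<Rightarrow> real" where
  "matrix_measure N A =
     Lim (at_right 0) (\<lambda>\<epsilon>. 1 / \<epsilon> * (induced_norm N (mat 1 + \<epsilon> *\<^sub>R A) - 1))"

(* Derivatives are taken within \<Omega>, the domain of f. They are two-sided at interior
   points and one-sided at boundary points. *)
definition jac :: "(real^'n \<Rightarrow> real^'n) \<Rightarrow> (real^'n) set \<Rightarrow> real^'n \<Rightarrow> real^'n^'n" where
  "jac f \<Omega> x = jacobian f (at x within \<Omega>)"

(* f is only meaningful on \<Omega>, so a solution has to take its values there. *)
definition is_solution ::
  "(real^'n \<Rightarrow> real^'n) \<Rightarrow> (real^'n) set \<Rightarrow> real \<Rightarrow> real^'n \<Rightarrow> (real \<Rightarrow> real^'n) \<Rightarrow> bool" where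
  "is_solution f \<Omega> t\<^sub>0 x\<^sub>0 y \<longleftrightarrow>
     y t\<^sub>0 = x\<^sub>0 \<and>
     (\<forall>t\<ge>t\<^sub>0. y t \<in> \<Omega> \<and> (y has_vector_derivative f (y t)) (at t within {t\<^sub>0..}))"

(* x t t0 x0 is the value at time t of the unique solution starting at x0 at time t0;
   it is unconstrained for t < t0, t0 < 0 or x0 outside \<Omega>. *)
definition solution_map ::
  "(real^'n \<Rightarrow> real^'n) \<Rightarrow> (real^'n) set \<Rightarrow> (real \<Rightarrow> real \<Rightarrow> real^'n \<Rightarrow> real^'n) \<Rightarrow> bool" where
  "solution_map f \<Omega> x \<longleftrightarrow>
     (\<forall>t\<^sub>0\<ge>0. \<forall>x\<^sub>0\<in>\<Omega>.
        is_solution f \<Omega> t\<^sub>0 x\<^sub>0 (\<lambda>t. x t t\<^sub>0 x\<^sub>0) \<and>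
        (\<forall>y. is_solution f \<Omega> t\<^sub>0 x\<^sub>0 y \<longrightarrow> (\<forall>t\<ge>t\<^sub>0. y t = x t t\<^sub>0 x\<^sub>0)))"

definition system_on ::
  "(real^'n \<Rightarrow> real^'n) \<Rightarrow> (real^'n) set \<Rightarrow> (real \<Rightarrow> real \<Rightarrow> real^'n \<Rightarrow> real^'n) \<Rightarrow> bool" where
  "system_on f \<Omega> x \<longleftrightarrow>
     f differentiable_on \<Omega> \<and> continuous_on \<Omega> f \<and> continuous_on \<Omega> (jac f \<Omega>) \<and>
     solution_map f \<Omega> x"

definition interior_contractive ::
  "(real^'n \<Rightarrow> real^'n) \<Rightarrow> (real^'n) set \<Rightarrow> (real \<Rightarrow> real \<Rightarrow> real^'n \<Rightarrow> real^'n) \<Rightarrow> bool" where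
  "interior_contractive f \<Omega> x \<longleftrightarrow>
     (\<forall>x\<^sub>0\<in>frontier \<Omega>. \<forall>t>0. x t 0 x\<^sub>0 \<notin> frontier \<Omega>) \<and>
     (\<exists>N. vector_norm N \<and> (\<forall>z\<in>interior \<Omega>. matrix_measure N (jac f \<Omega> z) < 0))"

definition contraction_after_short_transient ::
  "(real^'n) set \<Rightarrow> (real \<Rightarrow> real \<Rightarrow> real^'n \<Rightarrow> real^'n) \<Rightarrow> bool" where
  "contraction_after_short_transient \<Omega> x \<longleftrightarrow>
     (\<exists>N. vector_norm N \<and>
       (\<forall>\<tau>>0. \<exists>l>0. \<forall>t\<^sub>1 t\<^sub>2 a b. 0 \<le> t\<^sub>1 \<longrightarrow> t\<^sub>1 \<le> t\<^sub>2 \<longrightarrow> a \<in> \<Omega> \<longrightarrow> b \<in> \<Omega> \<longrightarrow>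
          N (x (t\<^sub>2 + \<tau>) t\<^sub>1 a - x (t\<^sub>2 + \<tau>) t\<^sub>1 b) \<le> exp (- (t\<^sub>2 - t\<^sub>1) * l) * N (a - b)))"

end

theory Submission
  imports Defs
begin

text \<open>
  Fix the norm \<open>N\<close> given by interior contractivity and let \<open>\<phi>\<^sub>t\<close> be the time-\<open>t\<close> map of the flow.
  The matrix measure of the Jacobian is negative inside \<open>\<Omega>\<close> but may tend to zero at the boundary,
  so no uniform rate is available on all of \<open>\<Omega>\<close>. The short transient repairs this: after any
  time \<open>\<tau> > 0\<close> all of \<open>\<Omega>\<close> has moved into a compact subset of its interior.

  The map \<open>\<phi>\<^sub>\<tau>\<close> is continuous and injective, since \<open>f\<close> is Lipschitz and Gronwall's inequality holds
  forwards and backwards in time. Invariance of domain then shows that \<open>\<phi>\<^sub>\<tau>\<close> maps interior points to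
  interior points, while boundary points leave the boundary by hypothesis. Hence \<open>\<phi>\<^sub>\<tau> ` \<Omega>\<close> is compact
  and interior (\<open>flow_image_compact_interior\<close>), and so is its convex hull \<open>H\<close>, because the interior
  of \<open>\<Omega>\<close> is convex. By the semigroup property, every orbit stays in \<open>H\<close> from time \<open>\<tau>\<close> on.

  For a matrix \<open>A\<close>, negativity of the matrix measure means that some explicit Euler step \<open>I + h A\<close>
  is a strict \<open>N\<close>-contraction. This is an open condition on \<open>A\<close>, so on the compact set \<open>H\<close> it holds
  with one constant \<open>k\<close> for all Jacobians (\<open>uniformly_contracting_on_compact\<close>). The mean value
  inequality turns it into a contraction estimate for Euler steps of \<open>f\<close> on pairs of points of the
  convex set \<open>H\<close>, and the Gronwall inequality \<open>vector_norm_gronwall\<close> passes from Euler steps to the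
  flow: distances decay at rate \<open>k\<close> after time \<open>\<tau>\<close> (\<open>uniform_contraction_after\<close>).

  It remains to see that nothing is lost during the transient. Applied with a starting time \<open>s\<close> in
  place of \<open>\<tau>\<close>, the same estimate says that distances do not grow after \<open>s\<close>, and \<open>s\<close> may tend
  to \<open>0\<close> (\<open>flow_nonexpansive\<close>). So \<open>\<ell>(\<tau>) = k\<close> works.
\<close>

section \<open>Vector norms\<close>

lemma vector_normD:
  assumes "vector_norm N"
  shows "0 \<le> N v" "N v = 0 \<longleftrightarrow> v = 0" "N (c *\<^sub>R v) = \<bar>c\<bar> * N v" "N (v + w) \<le> N v + N w"
  using assms unfolding vector_norm_def by blast+

lemma vector_norm_diff_commute: "vector_norm N \<Longrightarrow> N (v - w) = N (w - v)"
  using vector_normD(3)[of N "-1" "v - w"] by simp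

lemma vector_norm_diff_triangle: "vector_norm N \<Longrightarrow> N v - N w \<le> N (v - w)"
  using vector_normD(4)[of N "v - w" w] by simp

lemma vector_norm_norm: "vector_norm norm"
  unfolding vector_norm_def by (simp add: norm_triangle_ineq)

lemma vector_norm_sum_le: "vector_norm N \<Longrightarrow> N (sum g I) \<le> (\<Sum>i\<in>I. N (g i))"
proof (induction I rule: infinite_finite_induct)
  case (insert i I)
  then show ?case using vector_normD(4)[of N "g i" "sum g I"] by simp
next
  case (infinite I)
  then show ?case using vector_normD(2)[of N 0] by simp
next
  case empty
  then show ?case using vector_normD(2)[of N 0] by simp
qed

text \<open>All norms on a finite-dimensional space are equivalent. The first half, from the expansion in
  the standard basis, makes \<open>N\<close> continuous; then the minimum of \<open>N\<close> on the Euclidean unit sphere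
  gives the other half.\<close>

lemma vector_norm_le_norm:
  fixes N :: "real^'n \<Rightarrow> real"
  assumes N: "vector_norm N"
  shows "\<exists>C>0. \<forall>v. N v \<le> C * norm v"
proof -
  define C where "C = 1 + (\<Sum>i\<in>UNIV. N (axis i 1))"
  have C: "C > 0"
    unfolding C_def using sum_nonneg[of UNIV "\<lambda>i. N (axis i 1)"] vector_normD(1)[OF N]
    by (smt (verit))
  have "N v \<le> C * norm v" for v
  proof -
    have "v = (\<Sum>i\<in>UNIV. (v $ i) *\<^sub>R axis i 1)"
      by (metis (no_types, lifting) basis_expansion scalar_mult_eq_scaleR sum.cong)
    then have "N v \<le> (\<Sum>i\<in>UNIV. N ((v $ i) *\<^sub>R axis i 1))"
      using vector_norm_sum_le[OF N, of "\<lambda>i. (v $ i) *\<^sub>R axis i 1" UNIV] by simp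
    also have "\<dots> \<le> (\<Sum>i\<in>UNIV. norm v * N (axis i 1))"
      using component_le_norm_cart[of v]
      by (intro sum_mono) (simp add: vector_normD[OF N] mult_right_mono)
    also have "\<dots> \<le> C * norm v"
      by (simp add: C_def algebra_simps sum_distrib_left)
    finally show ?thesis .
  qed
  with C show ?thesis by blast
qed

lemma continuous_on_vector_norm:
  fixes N :: "real^'n \<Rightarrow> real"
  assumes N: "vector_norm N"
  shows "continuous_on S N"
proof -
  obtain C where C: "C > 0" "\<And>v. N v \<le> C * norm v"
    using vector_norm_le_norm[OF N] by blast
  have "C-lipschitz_on S N"
  proof (rule lipschitz_onI)
    fix v w
    have "\<bar>N v - N w\<bar> \<le> N (v - w)"
      using vector_norm_diff_triangle[OF N, of v w] vector_norm_diff_triangle[OF N, of w v]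
        vector_norm_diff_commute[OF N, of v w] by linarith
    then show "dist (N v) (N w) \<le> C * dist v w"
      using C(2)[of "v - w"] by (simp add: dist_norm)
  qed (use C in simp)
  then show ?thesis by (rule lipschitz_on_continuous_on)
qed

lemma norm_le_vector_norm:
  fixes N :: "real^'n \<Rightarrow> real"
  assumes N: "vector_norm N"
  shows "\<exists>C>0. \<forall>v. norm v \<le> C * N v"
proof -
  have "\<exists>x\<in>sphere 0 1. \<forall>y\<in>sphere (0::real^'n) 1. N x \<le> N y"
    by (rule continuous_attains_inf) (auto simp: continuous_on_vector_norm[OF N])
  then obtain x where x: "norm x = 1" "\<And>y. norm y = 1 \<Longrightarrow> N x \<le> N y" by auto
  have pos: "N x > 0" using x(1) vector_normD(1,2)[OF N, of x] by force
  have "norm v \<le> (1 / N x) * N v" for v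
  proof (cases "v = 0")
    case False
    then have "N x \<le> N ((1 / norm v) *\<^sub>R v)" by (intro x(2)) simp
    then show ?thesis using False pos by (simp add: vector_normD[OF N] field_simps)
  qed (simp add: vector_normD[OF N])
  with pos show ?thesis by (intro exI[of _ "1 / N x"]) simp
qed

lemma convex_vector_norm_le: "vector_norm N \<Longrightarrow> convex {v. N v \<le> B}"
proof (rule convexI, clarsimp)
  fix v w and p q :: real
  assume N: "vector_norm N" and h: "N v \<le> B" "N w \<le> B" "0 \<le> p" "0 \<le> q" "p + q = 1"
  have "N (p *\<^sub>R v + q *\<^sub>R w) \<le> p * N v + q * N w"
    using vector_normD(4)[OF N, of "p *\<^sub>R v" "q *\<^sub>R w"] h by (simp add: vector_normD(3)[OF N])
  also have "\<dots> \<le> p * B + q * B" using h by (intro add_mono mult_left_mono) auto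
  also have "\<dots> = B" using h by (metis distrib_right mult_1)
  finally show "N (p *\<^sub>R v + q *\<^sub>R w) \<le> B" .
qed

text \<open>A shorter step \<open>v + h w\<close> is a convex combination of \<open>v\<close> and the longer step \<open>v + b w\<close>.
  Hence growth factors of Euler steps are monotone in the step size, in the sense that the rate
  \<open>q\<close> of a long step also serves all shorter ones.\<close>

lemma vector_norm_step_shrink:
  assumes N: "vector_norm N" and le: "N (v + b *\<^sub>R w) \<le> (1 + b * q) * N v"
    and h: "0 \<le> h" "h \<le> b" "0 < b"
  shows "N (v + h *\<^sub>R w) \<le> (1 + h * q) * N v"
proof -
  have eq: "v + h *\<^sub>R w = (1 - h / b) *\<^sub>R v + (h / b) *\<^sub>R (v + b *\<^sub>R w)"
    using h by (simp add: algebra_simps)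
  have "N (v + h *\<^sub>R w) \<le> (1 - h / b) * N v + (h / b) * N (v + b *\<^sub>R w)"
    unfolding eq
    using vector_normD(4)[OF N, of "(1 - h / b) *\<^sub>R v" "(h / b) *\<^sub>R (v + b *\<^sub>R w)"] h
    by (simp add: vector_normD(3)[OF N])
  also have "\<dots> \<le> (1 - h / b) * N v + (h / b) * ((1 + b * q) * N v)"
    using le h by (intro add_left_mono mult_left_mono) auto
  also have "\<dots> = (1 + h * q) * N v" using h by (simp add: field_simps)
  finally show ?thesis .
qed

section \<open>Induced norms and the matrix measure\<close>

lemma norm_matrix_vector_mult_le: "norm (A *v v) \<le> norm A * norm (v :: real^'n)"
  for A :: "real^'n^'m"
proof -
  have "norm (A *v v) \<le> L2_set (\<lambda>i. norm (A $ i) * norm v) UNIV"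
    unfolding norm_vec_def[of "A *v v"]
  proof (rule L2_set_mono)
    fix i
    show "norm ((A *v v) $ i) \<le> norm (A $ i) * norm v"
      using Cauchy_Schwarz_ineq2[of "A $ i" v] by (simp add: matrix_vector_mul_component)
  qed simp
  also have "\<dots> = norm A * norm v"
    by (simp add: norm_vec_def[of A] L2_set_left_distrib)
  finally show ?thesis .
qed

lemma vector_norm_matrix_mult_le:
  fixes N :: "real^'n \<Rightarrow> real"
  assumes N: "vector_norm N"
  shows "\<exists>M>0. \<forall>(A :: real^'n^'n) v. N (A *v v) \<le> M * norm A * N v"
proof -
  obtain C where C: "C > 0" "\<And>v. N v \<le> C * norm v"
    using vector_norm_le_norm[OF N] by blast
  obtain C' where C': "C' > 0" "\<And>v. norm v \<le> C' * N v"
    using norm_le_vector_norm[OF N] by blast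
  have "N (A *v v) \<le> (C * C') * norm A * N v" for A :: "real^'n^'n" and v
  proof -
    have "N (A *v v) \<le> C * (norm A * norm v)"
      using C norm_matrix_vector_mult_le[of A v] by (meson less_imp_le mult_left_mono order_trans)
    also have "\<dots> \<le> C * (norm A * (C' * N v))"
      using C C' by (intro mult_left_mono) auto
    finally show ?thesis by (simp add: mult_ac)
  qed
  moreover have "C * C' > 0" using C C' by simp
  ultimately show ?thesis by blast
qed

lemma vector_norm_unit_exists:
  fixes N :: "real^'n \<Rightarrow> real"
  assumes N: "vector_norm N"
  obtains v where "N v = 1"
proof -
  obtain w :: "real^'n" where "w \<noteq> 0" by (metis axis_eq_0_iff zero_neq_one)
  then have "N w > 0" using vector_normD(1,2)[OF N, of w] by force
  then have "N ((1 / N w) *\<^sub>R w) = 1" by (simp add: vector_normD(3)[OF N])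
  then show ?thesis by (rule that)
qed

lemma induced_norm_bound:
  fixes N :: "real^'n \<Rightarrow> real"
  assumes N: "vector_norm N"
  shows "N (A *v v) \<le> induced_norm N A * N v"
proof (cases "v = 0")
  case False
  obtain M where M: "M > 0" "\<And>(A :: real^'n^'n) v. N (A *v v) \<le> M * norm A * N v"
    using vector_norm_matrix_mult_le[OF N] by blast
  have pos: "N v > 0" using False vector_normD(1,2)[OF N, of v] by force
  have "bdd_above ((\<lambda>x. N (A *v x)) ` {x. N x = 1})"
    by (intro bdd_aboveI2[where M = "M * norm A"]) (metis M(2) mem_Collect_eq mult.right_neutral)
  then have "N (A *v ((1 / N v) *\<^sub>R v)) \<le> induced_norm N A"
    unfolding induced_norm_def using pos
    by (intro cSUP_upper) (simp_all add: vector_normD(3)[OF N])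
  then have "(1 / N v) * N (A *v v) \<le> induced_norm N A"
    using pos by (simp add: matrix_vector_mult_scaleR vector_normD(3)[OF N])
  then show ?thesis using pos by (simp add: field_simps)
next
  case True
  then show ?thesis using vector_normD(2)[OF N, of 0] by simp
qed

lemma induced_norm_least:
  assumes N: "vector_norm N" and "\<And>v. N v = 1 \<Longrightarrow> N (A *v v) \<le> B"
  shows "induced_norm N A \<le> B"
proof -
  obtain v where "N v = 1" using vector_norm_unit_exists[OF N] by blast
  then show ?thesis unfolding induced_norm_def using assms(2) by (intro cSUP_least) auto
qed

lemma mat1_plus_mult: "(mat 1 + h *\<^sub>R A) *v v = v + h *\<^sub>R (A *v v)"
  for A :: "real^'n^'n"
  by (simp add: matrix_vector_mult_add_rdistrib scaleR_matrix_vector_assoc)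

text \<open>By convexity of the norm the difference quotient increases with \<open>h\<close>, and the triangle
  inequality bounds it below. So the defining limit exists and is an infimum, and its sign
  can be read off a single step size.\<close>

lemma matrix_measure_eq_Inf:
  fixes N :: "real^'n \<Rightarrow> real"
  assumes N: "vector_norm N"
  shows "matrix_measure N A
    = (INF h\<in>{0<..}. 1 / h * (induced_norm N (mat 1 + h *\<^sub>R A) - 1))"
proof -
  define q where "q h = 1 / h * (induced_norm N (mat 1 + h *\<^sub>R A) - 1)" for h
  have step: "N (v + h *\<^sub>R (A *v v)) \<le> (1 + h * q h) * N v" if "h > 0" for h v
    using induced_norm_bound[OF N, of "mat 1 + h *\<^sub>R A" v] that
    by (simp add: q_def mat1_plus_mult)
  have mono: "q a \<le> q b" if "0 < a" "a \<le> b" for a b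
  proof -
    have "induced_norm N (mat 1 + a *\<^sub>R A) \<le> 1 + a * q b"
    proof (rule induced_norm_least[OF N])
      fix v assume "N v = 1"
      then show "N ((mat 1 + a *\<^sub>R A) *v v) \<le> 1 + a * q b"
        using vector_norm_step_shrink[OF N step[of b v], of a] that by (simp add: mat1_plus_mult)
    qed
    then show ?thesis using that by (simp add: q_def[of a] field_simps)
  qed
  have bound: "- induced_norm N A \<le> q a" if "0 < a" for a
  proof -
    obtain v where v: "N v = 1" by (rule vector_norm_unit_exists[OF N])
    have "1 = N ((v + a *\<^sub>R (A *v v)) + (- a) *\<^sub>R (A *v v))" using v by simp
    also have "\<dots> \<le> N (v + a *\<^sub>R (A *v v)) + a * N (A *v v)"
      using vector_normD(4)[OF N, of "v + a *\<^sub>R (A *v v)" "(- a) *\<^sub>R (A *v v)"] that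
      by (simp add: vector_normD(3)[OF N, of "- a"] del: scaleR_minus_left)
    also have "\<dots> \<le> (1 + a * q a) + a * induced_norm N A"
      using step[OF that, of v] induced_norm_bound[OF N, of A v] that v
      by (intro add_mono mult_left_mono) auto
    finally have "0 \<le> a * (q a + induced_norm N A)" by (simp add: algebra_simps)
    then show ?thesis using that by (simp add: zero_le_mult_iff)
  qed
  have "(q \<longlongrightarrow> Inf (q ` ({0<..} \<inter> UNIV))) (at 0 within ({0<..} \<inter> UNIV))"
    by (rule Lim_right_bound[where K = "- induced_norm N A"]) (use mono bound in auto)
  then have "(q \<longlongrightarrow> Inf (q ` {0<..})) (at_right 0)" by simp
  then show ?thesis
    unfolding matrix_measure_def q_def[symmetric] by (intro tendsto_Lim) auto
qed

lemma matrix_measure_negD: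
  fixes N :: "real^'n \<Rightarrow> real"
  assumes N: "vector_norm N" and neg: "matrix_measure N A < 0"
  obtains b q where "b > 0" "q > 0" "\<And>v. N (v + b *\<^sub>R (A *v v)) \<le> (1 - b * q) * N v"
proof -
  have "\<exists>y\<in>(\<lambda>h. 1 / h * (induced_norm N (mat 1 + h *\<^sub>R A) - 1)) ` {0<..}. y < 0"
    using neg unfolding matrix_measure_eq_Inf[OF N] by (intro cInf_lessD) auto
  then obtain b where b: "b > 0" "1 / b * (induced_norm N (mat 1 + b *\<^sub>R A) - 1) < 0" by blast
  define q where "q = - (1 / b * (induced_norm N (mat 1 + b *\<^sub>R A) - 1))"
  have "N (v + b *\<^sub>R (A *v v)) \<le> (1 - b * q) * N v" for v
    using induced_norm_bound[OF N, of "mat 1 + b *\<^sub>R A" v] b(1) by (simp add: q_def mat1_plus_mult)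
  with b that[of b q] show ?thesis by (simp add: q_def)
qed

text \<open>The step size and the contraction rate are both \<open>k\<close>, although they are independent
  quantities: with a single parameter the condition is monotone (decreasing \<open>k\<close> only weakens
  it), which is convenient when a constant valid on a compact set is extracted.\<close>

definition contracting_matrix :: "(real^'n \<Rightarrow> real) \<Rightarrow> real \<Rightarrow> real^'n^'n \<Rightarrow> bool" where
  "contracting_matrix N k A \<longleftrightarrow> (\<forall>v. N (v + k *\<^sub>R (A *v v)) \<le> (1 - k * k) * N v)"

lemma contracting_matrixD:
  assumes "vector_norm N" "contracting_matrix N k A" "0 < k" "0 \<le> h" "h \<le> k"
  shows "N (v + h *\<^sub>R (A *v v)) \<le> (1 - h * k) * N v"
  using vector_norm_step_shrink[of N v k "A *v v" "- k" h] assms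
  by (simp add: contracting_matrix_def)

lemma contracting_matrix_mono:
  assumes N: "vector_norm N" and "contracting_matrix N k A" "0 < j" "j \<le> k"
  shows "contracting_matrix N j A"
  unfolding contracting_matrix_def
proof
  fix v
  have "N (v + j *\<^sub>R (A *v v)) \<le> (1 - j * k) * N v"
    using contracting_matrixD[OF assms(1,2)] assms by simp
  also have "\<dots> \<le> (1 - j * j) * N v"
    using assms vector_normD(1)[OF N] by (intro mult_right_mono) auto
  finally show "N (v + j *\<^sub>R (A *v v)) \<le> (1 - j * j) * N v" .
qed

text \<open>Half of the rate \<open>q\<close> of a contracting step pays for a small perturbation of the matrix.\<close>

lemma contracting_matrix_nhds:
  fixes N :: "real^'n \<Rightarrow> real"
  assumes N: "vector_norm N" and neg: "matrix_measure N A < 0"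
  obtains k where "k > 0" "eventually (contracting_matrix N k) (nhds A)"
proof -
  obtain b q where bq: "b > 0" "q > 0" "\<And>v. N (v + b *\<^sub>R (A *v v)) \<le> (1 - b * q) * N v"
    using matrix_measure_negD[OF N neg] by blast
  obtain M where M: "M > 0" "\<And>(A :: real^'n^'n) v. N (A *v v) \<le> M * norm A * N v"
    using vector_norm_matrix_mult_le[OF N] by blast
  define k where "k = min b (q / 2)"
  have k: "0 < k" "k \<le> b" "k \<le> q / 2" using bq by (auto simp: k_def)
  have "contracting_matrix N k A'" if "dist A' A < q / 2 / M" for A'
    unfolding contracting_matrix_def
  proof
    fix v
    have small: "M * norm (A' - A) \<le> q / 2"
      using that M(1) by (simp add: dist_norm field_simps)
    have "v + b *\<^sub>R (A' *v v) = (v + b *\<^sub>R (A *v v)) + b *\<^sub>R ((A' - A) *v v)"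
      by (simp add: algebra_simps)
    also have "N \<dots> \<le> N (v + b *\<^sub>R (A *v v)) + b * N ((A' - A) *v v)"
      using vector_normD(4)[OF N, of "v + b *\<^sub>R (A *v v)" "b *\<^sub>R ((A' - A) *v v)"] bq(1)
      by (simp add: vector_normD(3)[OF N])
    also have "\<dots> \<le> (1 - b * q) * N v + b * (q / 2 * N v)"
      using bq M(2)[of "A' - A" v] mult_right_mono[OF small vector_normD(1)[OF N, of v]]
      by (intro add_mono mult_left_mono) auto
    also have "\<dots> = (1 + b * - (q / 2)) * N v" by (simp add: algebra_simps)
    finally have "N (v + k *\<^sub>R (A' *v v)) \<le> (1 + k * - (q / 2)) * N v"
      by (rule vector_norm_step_shrink[OF N]) (use k bq in auto)
    also have "\<dots> \<le> (1 - k * k) * N v"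
      using k mult_left_mono[OF k(3), of k] vector_normD(1)[OF N] by (intro mult_right_mono) auto
    finally show "N (v + k *\<^sub>R (A' *v v)) \<le> (1 - k * k) * N v" .
  qed
  then have "eventually (contracting_matrix N k) (nhds A)"
    unfolding eventually_nhds_metric using bq(2) M(1) by (intro exI[of _ "q / 2 / M"]) auto
  with k(1) that show ?thesis by blast
qed

lemma uniformly_contracting_on_compact:
  fixes N :: "real^'n \<Rightarrow> real" and J :: "'b :: metric_space \<Rightarrow> real^'n^'n"
  assumes N: "vector_norm N" and "compact H" and cont: "continuous_on H J"
    and neg: "\<And>z. z \<in> H \<Longrightarrow> matrix_measure N (J z) < 0"
  obtains k where "k > 0" "\<And>z. z \<in> H \<Longrightarrow> contracting_matrix N k (J z)"
proof -
  have "\<exists>k>0. \<forall>z\<in>H. contracting_matrix N k (J z)"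
  proof (rule ccontr)
    assume "\<not> ?thesis"
    then have "\<forall>n. \<exists>z\<in>H. \<not> contracting_matrix N (1 / real (Suc n)) (J z)"
      by (metis of_nat_0_less_iff zero_less_Suc zero_less_divide_1_iff)
    then obtain z where z: "\<And>n. z n \<in> H"
      "\<And>n. \<not> contracting_matrix N (1 / real (Suc n)) (J (z n))" by metis
    obtain l r where l: "l \<in> H" "strict_mono r" "(z \<circ> r) \<longlonglongrightarrow> l"
      using compact_def[THEN iffD1, OF \<open>compact H\<close>, rule_format, of z, OF z(1)] by auto
    obtain k where k: "k > 0" "eventually (contracting_matrix N k) (nhds (J l))"
      using contracting_matrix_nhds[OF N neg[OF l(1)]] by blast
    have "(\<lambda>n. J ((z \<circ> r) n)) \<longlonglongrightarrow> J l"
      using continuous_on_tendsto_compose[OF cont l(3,1)] z(1) by simp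
    then have 1: "\<forall>\<^sub>F n in sequentially. contracting_matrix N k (J ((z \<circ> r) n))"
      using k(2) by (simp add: filterlim_iff)
    have "(\<lambda>n. 1 / real (Suc n)) \<longlonglongrightarrow> 0" by (rule LIMSEQ_Suc[OF lim_1_over_n])
    then have "((\<lambda>n. 1 / real (Suc n)) \<circ> r) \<longlonglongrightarrow> 0" by (rule LIMSEQ_subseq_LIMSEQ[OF _ l(2)])
    then have 2: "\<forall>\<^sub>F n in sequentially. 1 / real (Suc (r n)) < k"
      using order_tendstoD(2)[OF _ k(1)] by (simp add: o_def)
    obtain n where "contracting_matrix N k (J (z (r n)))" "1 / real (Suc (r n)) < k"
      using eventually_happens'[OF _ eventually_conj[OF 1 2]] by auto
    then show False using z(2)[of "r n"] contracting_matrix_mono[OF N] by auto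
  qed
  with that show ?thesis by blast
qed

section \<open>Mean value and Gronwall inequalities for an arbitrary norm\<close>

text \<open>A ball of \<open>N\<close> is closed and convex, hence an intersection of half-spaces. If the increment
  of \<open>g\<close> left the ball of radius \<open>B\<close>, a separating functional would, by the scalar mean value
  theorem along the segment, take a derivative \<open>g' z (a - b)\<close> out of that ball too.\<close>

lemma vector_norm_mean_value:
  fixes N :: "real^'n \<Rightarrow> real"
  assumes N: "vector_norm N" and S: "convex S" "a \<in> S" "b \<in> S"
    and deriv: "\<And>z. z \<in> S \<Longrightarrow> (g has_derivative g' z) (at z within S)"
    and bound: "\<And>z. z \<in> S \<Longrightarrow> N (g' z (a - b)) \<le> B"
  shows "N (g a - g b) \<le> B"
proof (rule ccontr)
  assume "\<not> ?thesis"
  then have "g a - g b \<notin> {v. N v \<le> B}" by simp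
  moreover have "closed {v. N v \<le> B}"
    by (intro closed_Collect_le continuous_on_const continuous_on_vector_norm[OF N])
  ultimately obtain w \<beta> where w: "w \<bullet> (g a - g b) < \<beta>" "\<And>v. N v \<le> B \<Longrightarrow> w \<bullet> v > \<beta>"
    using separating_hyperplane_closed_point[OF convex_vector_norm_le[OF N]] by blast
  define p where "p s = b + s *\<^sub>R (a - b)" for s :: real
  have p: "p s \<in> S" if "s \<in> {0..1}" for s
  proof -
    have "p s = (1 - s) *\<^sub>R b + s *\<^sub>R a" by (simp add: p_def algebra_simps)
    then show ?thesis using S that by (simp add: convex_def)
  qed
  have "((\<lambda>s. w \<bullet> g (p s)) has_derivative (\<lambda>r. w \<bullet> g' (p s) (r *\<^sub>R (a - b)))) (at s within {0..1})"
    if "0 \<le> s" "s \<le> 1" for s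
  proof -
    have "(p has_derivative (\<lambda>r. r *\<^sub>R (a - b))) (at s within {0..1})"
      unfolding p_def by (auto intro!: derivative_eq_intros)
    moreover have "p ` {0..1} \<subseteq> S" using p by blast
    ultimately have "((\<lambda>s. g (p s)) has_derivative (\<lambda>r. g' (p s) (r *\<^sub>R (a - b)))) (at s within {0..1})"
      using has_derivative_in_compose2[of S g g' p "{0..1}" s] deriv that by auto
    then show ?thesis by (intro has_derivative_inner_right)
  qed
  from mvt_simple[OF zero_less_one this] obtain s where
    s: "s \<in> {0<..<1}" "w \<bullet> g (p 1) - w \<bullet> g (p 0) = w \<bullet> g' (p s) ((1 - 0) *\<^sub>R (a - b))" by blast
  then have "w \<bullet> (g a - g b) = w \<bullet> g' (p s) (a - b)" by (simp add: p_def inner_diff_right)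
  also have "\<dots> > \<beta>" using s(1) by (intro w(2) bound p) auto
  finally show False using w(1) by simp
qed

text \<open>The function \<open>N \<circ> D\<close> need not be differentiable, so monotonicity is obtained from Euler steps:
  \<open>N (D q) \<le> N (D p) + e (q - p)\<close> holds locally for each \<open>e > 0\<close>, is additive over adjacent
  intervals, and therefore holds globally by the bisection principle \<open>Bolzano\<close>.\<close>

lemma vector_norm_antimono:
  fixes N :: "real^'n \<Rightarrow> real"
  assumes N: "vector_norm N" and "s \<le> T"
    and deriv: "\<And>t. t \<in> {s..T} \<Longrightarrow> (D has_vector_derivative D' t) (at t within {s..T})"
    and euler: "\<And>t. t \<in> {s..T} \<Longrightarrow> \<exists>\<eta>>0. \<forall>h. 0 \<le> h \<longrightarrow> h \<le> \<eta> \<longrightarrow> N (D t + h *\<^sub>R D' t) \<le> N (D t)"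
  shows "N (D T) \<le> N (D s)"
proof -
  obtain C where C: "C > 0" "\<And>v. N v \<le> C * norm v"
    using vector_norm_le_norm[OF N] by blast
  have approx: "N (D T) \<le> N (D s) + e * (T - s)" if "e > 0" for e
  proof -
    define P where "P p q \<longleftrightarrow> (s \<le> p \<and> q \<le> T \<longrightarrow> N (D q) \<le> N (D p) + e * (q - p))" for p q
    have "P s T"
      using \<open>s \<le> T\<close>
    proof (induction rule: Bolzano)
      case (trans p q r)
      then show ?case by (auto simp: P_def algebra_simps)
    next
      case (local x)
      have D: "(D has_derivative (\<lambda>h. h *\<^sub>R D' x)) (at x within {s..T})"
        using deriv[of x] local by (simp add: has_vector_derivative_def)
      obtain d where d: "d > 0" "\<And>y. y \<in> {s..T} \<Longrightarrow> norm (y - x) < d \<Longrightarrow>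
          norm (D y - D x - (y - x) *\<^sub>R D' x) \<le> e / C * norm (y - x)"
        using D C(1) \<open>e > 0\<close> unfolding has_derivative_within_alt
        by (meson divide_pos_pos)
      have near: "N (D y - D x - (y - x) *\<^sub>R D' x) \<le> e * \<bar>y - x\<bar>"
        if "y \<in> {s..T}" "\<bar>y - x\<bar> < d" for y
      proof -
        let ?r = "D y - D x - (y - x) *\<^sub>R D' x"
        have "N ?r \<le> C * norm ?r" by (rule C(2))
        also have "\<dots> \<le> C * (e / C * norm (y - x))"
          using d(2)[of y] that C(1) by (intro mult_left_mono) auto
        also have "\<dots> = e * \<bar>y - x\<bar>" using C(1) by simp
        finally show ?thesis .
      qed
      obtain \<eta> where eta: "\<eta> > 0" "\<And>h. 0 \<le> h \<Longrightarrow> h \<le> \<eta> \<Longrightarrow> N (D x + h *\<^sub>R D' x) \<le> N (D x)"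
        using euler[of x] local by auto
      have "N (D q) \<le> N (D p) + e * (q - p)"
        if pq: "p \<le> x" "x \<le> q" "q - p < min d \<eta>" "s \<le> p" "q \<le> T" for p q
      proof -
        have "N (D q) \<le> N (D x + (q - x) *\<^sub>R D' x) + N (D q - D x - (q - x) *\<^sub>R D' x)"
          using vector_normD(4)[OF N, of "D x + (q - x) *\<^sub>R D' x" "D q - D x - (q - x) *\<^sub>R D' x"]
          by simp
        also have "\<dots> \<le> N (D x) + e * (q - x)"
          using near[of q] eta(2)[of "q - x"] pq by (intro add_mono) auto
        finally have right: "N (D q) \<le> N (D x) + e * (q - x)" .
        \<comment> \<open>To the left of \<open>x\<close> the Euler step is backwards; as \<open>D x\<close> is the midpoint of the
          forward and the backward step, and the forward step does not increase \<open>N\<close>, the backward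
          step does not decrease it.\<close>
        have "2 * N (D x) = N (2 *\<^sub>R D x)" by (simp add: vector_normD(3)[OF N])
        also have "2 *\<^sub>R D x = (D x + (x - p) *\<^sub>R D' x) + (D x + (p - x) *\<^sub>R D' x)"
          by (simp add: algebra_simps scaleR_2)
        also have "N \<dots> \<le> N (D x) + N (D x + (p - x) *\<^sub>R D' x)"
          using eta(2)[of "x - p"] pq
            vector_normD(4)[OF N, of "D x + (x - p) *\<^sub>R D' x" "D x + (p - x) *\<^sub>R D' x"] by auto
        finally have "N (D x) \<le> N (D x + (p - x) *\<^sub>R D' x)" by simp
        also have "\<dots> \<le> N (D p) + N (D p - D x - (p - x) *\<^sub>R D' x)"
          using vector_norm_diff_triangle[OF N, of "D x + (p - x) *\<^sub>R D' x" "D p"]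
            vector_norm_diff_commute[OF N, of "D x + (p - x) *\<^sub>R D' x" "D p"]
          by (simp add: algebra_simps)
        also have "\<dots> \<le> N (D p) + e * (x - p)" using near[of p] pq by auto
        finally show ?thesis using right by (simp add: algebra_simps)
      qed
      then show ?case unfolding P_def using d(1) eta(1) by (intro exI[of _ "min d \<eta>"]) auto
    qed
    then show ?thesis by (simp add: P_def)
  qed
  show ?thesis
  proof (cases "s = T")
    case False
    then have "s < T" using \<open>s \<le> T\<close> by simp
    show ?thesis
    proof (rule field_le_epsilon)
      fix e :: real assume "e > 0"
      then show "N (D T) \<le> N (D s) + e"
        using approx[of "e / (T - s)"] \<open>s < T\<close> by simp
    qed
  qed simp
qed

text \<open>Multiplying by the integrating factor \<open>exp (- c t)\<close> reduces the claim to the monotone case. The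
  rate \<open>c\<close> may have either sign: a negative \<open>c\<close> gives exponential decay, a Lipschitz constant
  gives the classical growth bound.\<close>

lemma vector_norm_gronwall:
  fixes N :: "real^'n \<Rightarrow> real"
  assumes N: "vector_norm N" and "s \<le> T"
    and deriv: "\<And>t. t \<in> {s..T} \<Longrightarrow> (u has_vector_derivative u' t) (at t within {s..T})"
    and "\<eta> > 0"
    and euler: "\<And>t h. t \<in> {s..T} \<Longrightarrow> 0 \<le> h \<Longrightarrow> h \<le> \<eta> \<Longrightarrow>
      N (u t + h *\<^sub>R u' t) \<le> (1 + h * c) * N (u t)"
  shows "N (u T) \<le> exp (c * (T - s)) * N (u s)"
proof -
  define D where "D t = exp (- c * t) *\<^sub>R u t" for t
  define D' where "D' t = exp (- c * t) *\<^sub>R (u' t - c *\<^sub>R u t)" for t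
  have "N (D T) \<le> N (D s)"
  proof (rule vector_norm_antimono[OF N \<open>s \<le> T\<close>])
    fix t assume t: "t \<in> {s..T}"
    show "(D has_vector_derivative D' t) (at t within {s..T})"
      unfolding D_def D'_def
      by (rule has_vector_derivative_eq_rhs, rule has_vector_derivative_scaleR[OF _ deriv[OF t]])
        (auto intro!: derivative_eq_intros simp: algebra_simps)
    \<comment> \<open>For \<open>h \<le> \<delta>\<close> the factor \<open>1 - h c\<close> is at least \<open>1/2\<close>, so the rescaled step is at most \<open>\<eta>\<close>.\<close>
    define \<delta> where "\<delta> = min (\<eta> / 2) (1 / (2 * (\<bar>c\<bar> + 1)))"
    have "\<delta> > 0" using \<open>\<eta> > 0\<close> by (simp add: \<delta>_def)
    moreover have "N (D t + h *\<^sub>R D' t) \<le> N (D t)" if h: "0 \<le> h" "h \<le> \<delta>" for h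
    proof -
      have "h * (2 * (\<bar>c\<bar> + 1)) \<le> 1" using h by (simp add: \<delta>_def field_simps)
      moreover have "h * c \<le> h * (\<bar>c\<bar> + 1)" using h by (intro mult_left_mono) auto
      ultimately have g: "1 - h * c \<ge> 1 / 2" by (simp add: algebra_simps)
      \<comment> \<open>Up to the factor \<open>1 - h c\<close>, an Euler step of size \<open>h\<close> for \<open>D\<close> is one of size \<open>h'\<close> for
        \<open>u\<close>; its growth factor \<open>1 + h' c\<close> is exactly the inverse of \<open>1 - h c\<close>.\<close>
      define h' where "h' = h / (1 - h * c)"
      have h': "0 \<le> h'" using h g by (simp add: h'_def)
      have "h' \<le> h / (1 / 2)" unfolding h'_def using h g by (intro divide_left_mono) auto
      also have "\<dots> \<le> \<eta>" using h by (simp add: \<delta>_def)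
      finally have h'2: "h' \<le> \<eta>" .
      have eq: "(1 - h * c) * h' = h" using g by (simp add: h'_def)
      have "D t + h *\<^sub>R D' t = exp (- c * t) *\<^sub>R ((1 - h * c) *\<^sub>R u t + h *\<^sub>R u' t)"
        by (simp add: D_def D'_def algebra_simps)
      also have "\<dots> = exp (- c * t) *\<^sub>R ((1 - h * c) *\<^sub>R u t + ((1 - h * c) * h') *\<^sub>R u' t)"
        using eq by simp
      also have "\<dots> = (exp (- c * t) * (1 - h * c)) *\<^sub>R (u t + h' *\<^sub>R u' t)"
        by (simp add: scaleR_add_right)
      finally have "D t + h *\<^sub>R D' t = (exp (- c * t) * (1 - h * c)) *\<^sub>R (u t + h' *\<^sub>R u' t)" .
      then have "N (D t + h *\<^sub>R D' t) = exp (- c * t) * (1 - h * c) * N (u t + h' *\<^sub>R u' t)"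
        using g by (simp add: vector_normD(3)[OF N])
      also have "\<dots> \<le> exp (- c * t) * (1 - h * c) * ((1 + h' * c) * N (u t))"
        using euler[OF t h' h'2] g by (intro mult_left_mono) auto
      also have "\<dots> = exp (- c * t) * ((1 - h * c) * (1 + h' * c)) * N (u t)" by simp
      also have "(1 - h * c) * (1 + h' * c) = 1" using g by (simp add: h'_def field_simps)
      finally show ?thesis by (simp add: D_def vector_normD(3)[OF N])
    qed
    ultimately show "\<exists>\<eta>>0. \<forall>h. 0 \<le> h \<longrightarrow> h \<le> \<eta> \<longrightarrow> N (D t + h *\<^sub>R D' t) \<le> N (D t)" by blast
  qed
  then have "exp (- c * T) * N (u T) \<le> exp (- c * s) * N (u s)"
    by (simp add: D_def vector_normD(3)[OF N])
  then have "exp (c * T) * (exp (- c * T) * N (u T)) \<le> exp (c * T) * (exp (- c * s) * N (u s))"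
    by (intro mult_left_mono) auto
  then show ?thesis by (simp add: algebra_simps flip: exp_add mult.assoc)
qed

section \<open>The flow\<close>

lemma is_solution_shift:
  assumes "is_solution f \<Omega> r a y" and "r \<le> s + d"
  shows "is_solution f \<Omega> s (y (s + d)) (\<lambda>t. y (t + d))"
  unfolding is_solution_def
proof (intro conjI allI impI)
  fix t assume t: "s \<le> t"
  let ?g = "\<lambda>t. t + d"
  have g: "r \<le> ?g t" using t assms(2) by simp
  then show "y (?g t) \<in> \<Omega>" using assms by (simp add: is_solution_def)
  have "(y has_vector_derivative f (y (?g t))) (at (?g t) within {r..})"
    using g assms by (simp add: is_solution_def)
  then have "(y has_vector_derivative f (y (?g t))) (at (?g t) within ?g ` {s..})"
    by (rule has_vector_derivative_within_subset) (use assms(2) in auto)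
  moreover have "(?g has_vector_derivative 1) (at t within {s..})"
    by (auto intro!: derivative_eq_intros)
  ultimately show "((\<lambda>t. y (?g t)) has_vector_derivative f (y (?g t))) (at t within {s..})"
    using vector_diff_chain_within[of ?g 1 t "{s..}" y "f (y (?g t))"] by (simp add: o_def)
qed simp

text \<open>By uniqueness, a solution restarted at a point of its orbit is the solution from that point.
  This one identity gives both time invariance (with \<open>p = r\<close>) and the semigroup property of the flow
  (with \<open>r = s = 0\<close>).\<close>

lemma solution_map_shift:
  assumes x: "solution_map f \<Omega> x" and "0 \<le> r" "r \<le> p" "0 \<le> s" "s \<le> t" "a \<in> \<Omega>"
  shows "x (t + (p - s)) r a = x t s (x p r a)"
proof -
  have sol: "is_solution f \<Omega> r a (\<lambda>t. x t r a)"
    using assms unfolding solution_map_def by blast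
  have "is_solution f \<Omega> s (x p r a) (\<lambda>t. x (t + (p - s)) r a)"
    using is_solution_shift[OF sol, of s "p - s"] assms by simp
  moreover have "x p r a \<in> \<Omega>" using sol assms by (simp add: is_solution_def)
  ultimately show ?thesis using x assms unfolding solution_map_def by blast
qed

lemma solution_map_is_solution:
  "solution_map f \<Omega> x \<Longrightarrow> a \<in> \<Omega> \<Longrightarrow> is_solution f \<Omega> 0 a (\<lambda>t. x t 0 a)"
  unfolding solution_map_def by blast

lemma solution_map_initial: "solution_map f \<Omega> x \<Longrightarrow> a \<in> \<Omega> \<Longrightarrow> x 0 0 a = a"
  using solution_map_is_solution[of f \<Omega> x a] by (simp add: is_solution_def)

lemma solution_map_mem: "solution_map f \<Omega> x \<Longrightarrow> a \<in> \<Omega> \<Longrightarrow> 0 \<le> t \<Longrightarrow> x t 0 a \<in> \<Omega>"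
  using solution_map_is_solution[of f \<Omega> x a] by (simp add: is_solution_def)

lemma solution_map_deriv:
  assumes x: "solution_map f \<Omega> x" and "a \<in> \<Omega>" "0 \<le> t" "S \<subseteq> {0..}"
  shows "((\<lambda>t. x t 0 a) has_vector_derivative f (x t 0 a)) (at t within S)"
proof -
  have "((\<lambda>t. x t 0 a) has_vector_derivative f (x t 0 a)) (at t within {0..})"
    using solution_map_is_solution[OF x \<open>a \<in> \<Omega>\<close>] \<open>0 \<le> t\<close> by (simp add: is_solution_def)
  then show ?thesis
    using \<open>S \<subseteq> {0..}\<close> by (rule has_vector_derivative_within_subset)
qed

lemma jac_has_derivative:
  assumes "f differentiable_on \<Omega>" "z \<in> \<Omega>" "S \<subseteq> \<Omega>"
  shows "(f has_derivative (*v) (jac f \<Omega> z)) (at z within S)"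
proof -
  have "(f has_derivative (*v) (jac f \<Omega> z)) (at z within \<Omega>)"
    using assms(1,2) jacobian_works[of f "at z within \<Omega>"]
    by (simp add: differentiable_on_def jac_def)
  then show ?thesis using \<open>S \<subseteq> \<Omega>\<close> by (rule has_derivative_subset)
qed

lemma system_lipschitz:
  fixes f :: "real^'n \<Rightarrow> real^'n"
  assumes "compact \<Omega>" "convex \<Omega>" "system_on f \<Omega> x"
  obtains L where "L > 0" "\<And>a b. a \<in> \<Omega> \<Longrightarrow> b \<in> \<Omega> \<Longrightarrow> norm (f a - f b) \<le> L * norm (a - b)"
proof -
  have sys: "f differentiable_on \<Omega>" "continuous_on \<Omega> (jac f \<Omega>)"
    using assms by (auto simp: system_on_def)
  obtain L where L: "L > 0" "\<And>z. z \<in> \<Omega> \<Longrightarrow> norm (jac f \<Omega> z) \<le> L"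
    using compact_imp_bounded[OF compact_continuous_image[OF sys(2) assms(1)]]
    unfolding bounded_pos by auto
  have "norm (f a - f b) \<le> L * norm (a - b)" if "a \<in> \<Omega>" "b \<in> \<Omega>" for a b
  proof (rule vector_norm_mean_value[OF vector_norm_norm assms(2) that])
    fix z assume z: "z \<in> \<Omega>"
    then show "(f has_derivative (*v) (jac f \<Omega> z)) (at z within \<Omega>)"
      using jac_has_derivative[OF sys(1)] by blast
    show "norm (jac f \<Omega> z *v (a - b)) \<le> L * norm (a - b)"
      using norm_matrix_vector_mult_le[of "jac f \<Omega> z" "a - b"] mult_right_mono[OF L(2)[OF z], of "norm (a - b)"]
      by simp
  qed
  with L(1) that show ?thesis by blast
qed

text \<open>The second bound is the first one for the difference of the orbits run backwards in time; it
  makes the time-\<open>t\<close> map injective.\<close>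

lemma flow_bi_lipschitz:
  fixes f :: "real^'n \<Rightarrow> real^'n"
  assumes x: "solution_map f \<Omega> x" and "0 \<le> t" and ab: "a \<in> \<Omega>" "b \<in> \<Omega>"
    and L: "L > 0" "\<And>a b. a \<in> \<Omega> \<Longrightarrow> b \<in> \<Omega> \<Longrightarrow> norm (f a - f b) \<le> L * norm (a - b)"
  shows "norm (x t 0 a - x t 0 b) \<le> exp (L * t) * norm (a - b)"
    and "norm (a - b) \<le> exp (L * t) * norm (x t 0 a - x t 0 b)"
proof -
  define u where "u r = x r 0 a - x r 0 b" for r
  define u' where "u' r = f (x r 0 a) - f (x r 0 b)" for r
  have u: "(u has_vector_derivative u' r) (at r within {0..t})" if "r \<in> {0..t}" for r
    unfolding u_def u'_def using that ab
    by (intro has_vector_derivative_diff solution_map_deriv[OF x]) auto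
  have le: "norm (u' r) \<le> L * norm (u r)" if "r \<in> {0..t}" for r
    unfolding u_def u'_def using that ab by (intro L(2) solution_map_mem[OF x]) auto
  have euler: "norm (u r + h *\<^sub>R w) \<le> (1 + h * L) * norm (u r)"
    if "r \<in> {0..t}" "0 \<le> h" "norm w = norm (u' r)" for r h w
    using norm_triangle_ineq[of "u r" "h *\<^sub>R w"] mult_left_mono[OF le[OF that(1)] that(2)] that(2,3)
    by (simp add: algebra_simps)
  have "norm (u t) \<le> exp (L * (t - 0)) * norm (u 0)"
    by (rule vector_norm_gronwall[OF vector_norm_norm assms(2) u zero_less_one]) (auto intro: euler)
  then show "norm (x t 0 a - x t 0 b) \<le> exp (L * t) * norm (a - b)"
    using ab by (simp add: u_def solution_map_initial[OF x])
  have "((\<lambda>r. u (t - r)) has_vector_derivative - u' (t - r)) (at r within {0..t})"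
    if r: "r \<in> {0..t}" for r
  proof -
    have "(u has_vector_derivative u' (t - r)) (at (t - r) within (\<lambda>r. t - r) ` {0..t})"
      using u[of "t - r"] r by (auto intro: has_vector_derivative_within_subset)
    moreover have "((\<lambda>r. t - r) has_vector_derivative - 1) (at r within {0..t})"
      by (auto intro!: derivative_eq_intros)
    ultimately show ?thesis
      using vector_diff_chain_within[of "\<lambda>r. t - r" "-1" r "{0..t}" u "u' (t - r)"]
      by (simp add: o_def)
  qed
  moreover have "norm (u (t - r) + h *\<^sub>R - u' (t - r)) \<le> (1 + h * L) * norm (u (t - r))"
    if "r \<in> {0..t}" "0 \<le> h" for r h
    using that by (intro euler) auto
  ultimately have "norm (u (t - t)) \<le> exp (L * (t - 0)) * norm (u (t - 0))"
    by (intro vector_norm_gronwall[OF vector_norm_norm assms(2) _ zero_less_one,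
          where u = "\<lambda>r. u (t - r)" and u' = "\<lambda>r. - u' (t - r)"])
  then show "norm (a - b) \<le> exp (L * t) * norm (x t 0 a - x t 0 b)"
    using ab by (simp add: u_def solution_map_initial[OF x])
qed

text \<open>A trajectory starting in the interior cannot even touch the boundary: the time-\<open>t\<close> map is
  continuous and injective, so by invariance of domain it maps the interior to an open subset
  of \<open>\<Omega>\<close>.\<close>

lemma flow_image_compact_interior:
  fixes f :: "real^'n \<Rightarrow> real^'n"
  assumes "compact \<Omega>" "convex \<Omega>" and sys: "system_on f \<Omega> x"
    and leave: "\<And>a t. a \<in> frontier \<Omega> \<Longrightarrow> t > 0 \<Longrightarrow> x t 0 a \<notin> frontier \<Omega>" and "t > 0"
  shows "compact (x t 0 ` \<Omega>)" "x t 0 ` \<Omega> \<subseteq> interior \<Omega>"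
proof -
  have x: "solution_map f \<Omega> x" using sys by (simp add: system_on_def)
  obtain L where L: "L > 0" "\<And>a b. a \<in> \<Omega> \<Longrightarrow> b \<in> \<Omega> \<Longrightarrow> norm (f a - f b) \<le> L * norm (a - b)"
    using system_lipschitz[OF assms(1,2) sys] by blast
  note bi = flow_bi_lipschitz[OF x less_imp_le[OF \<open>t > 0\<close>] _ _ L]
  have "(exp (L * t))-lipschitz_on \<Omega> (x t 0)"
    using bi(1) by (intro lipschitz_onI) (auto simp: dist_norm)
  then have cont: "continuous_on \<Omega> (x t 0)" by (rule lipschitz_on_continuous_on)
  then show "compact (x t 0 ` \<Omega>)" using assms(1) by (rule compact_continuous_image)
  have inj: "inj_on (x t 0) \<Omega>"
    using bi(2) by (intro inj_onI) (metis cancel_comm_monoid_add_class.diff_cancel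
        eq_iff_diff_eq_0 mult_zero_right norm_le_zero_iff norm_zero)
  have into: "x t 0 a \<in> \<Omega>" if "a \<in> \<Omega>" for a
    using solution_map_mem[OF x that, of t] \<open>t > 0\<close> by simp
  have "open (x t 0 ` interior \<Omega>)"
    by (intro invariance_of_domain open_interior continuous_on_subset[OF cont]
        inj_on_subset[OF inj] interior_subset)
  then have int: "x t 0 ` interior \<Omega> \<subseteq> interior \<Omega>"
    using into interior_subset by (intro interior_maximal) blast+
  show "x t 0 ` \<Omega> \<subseteq> interior \<Omega>"
  proof clarify
    fix a assume a: "a \<in> \<Omega>"
    show "x t 0 a \<in> interior \<Omega>"
    proof (cases "a \<in> interior \<Omega>")
      case False
      then have "a \<in> frontier \<Omega>" using a closure_subset by (auto simp: frontier_def)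
      then have "x t 0 a \<notin> frontier \<Omega>" using leave \<open>t > 0\<close> by blast
      then show ?thesis using into[OF a] closure_subset by (auto simp: frontier_def)
    qed (use int in auto)
  qed
qed

text \<open>The mean value inequality needs the Jacobian on the whole segment between two orbit points.
  This is why the constant is taken on the convex hull of the image of \<open>\<Omega>\<close> and not on the image
  itself.\<close>

lemma uniform_contraction_after:
  fixes f :: "real^'n \<Rightarrow> real^'n"
  assumes "compact \<Omega>" "convex \<Omega>" and sys: "system_on f \<Omega> x"
    and leave: "\<And>a t. a \<in> frontier \<Omega> \<Longrightarrow> t > 0 \<Longrightarrow> x t 0 a \<notin> frontier \<Omega>"
    and N: "vector_norm N"
    and neg: "\<And>z. z \<in> interior \<Omega> \<Longrightarrow> matrix_measure N (jac f \<Omega> z) < 0"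
    and "s > 0"
  shows "\<exists>k>0. \<forall>a\<in>\<Omega>. \<forall>b\<in>\<Omega>. \<forall>t\<ge>s.
      N (x t 0 a - x t 0 b) \<le> exp (- k * (t - s)) * N (x s 0 a - x s 0 b)"
proof -
  have x: "solution_map f \<Omega> x" and diff: "f differentiable_on \<Omega>"
    and J: "continuous_on \<Omega> (jac f \<Omega>)"
    using sys by (auto simp: system_on_def)
  define H where "H = convex hull (x s 0 ` \<Omega>)"
  note K = flow_image_compact_interior[OF assms(1-4) \<open>s > 0\<close>]
  have H: "compact H" "H \<subseteq> interior \<Omega>" "H \<subseteq> \<Omega>" "convex H"
    using compact_convex_hull[OF K(1)] hull_minimal[of _ "interior \<Omega>" convex, OF K(2)]
      convex_interior[OF assms(2)] interior_subset[of \<Omega>]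
    unfolding H_def by auto
  obtain k where k: "k > 0" "\<And>z. z \<in> H \<Longrightarrow> contracting_matrix N k (jac f \<Omega> z)"
    using uniformly_contracting_on_compact[OF N H(1) continuous_on_subset[OF J H(3)]] neg H(2)
    by blast
  have step: "N (a - b + h *\<^sub>R (f a - f b)) \<le> (1 + h * - k) * N (a - b)"
    if ab: "a \<in> H" "b \<in> H" and h: "0 \<le> h" "h \<le> k" for a b h
  proof -
    have "N ((a + h *\<^sub>R f a) - (b + h *\<^sub>R f b)) \<le> (1 - h * k) * N (a - b)"
    proof (rule vector_norm_mean_value[OF N H(4) ab])
      fix z assume z: "z \<in> H"
      show "((\<lambda>z. z + h *\<^sub>R f z) has_derivative (\<lambda>v. v + h *\<^sub>R (jac f \<Omega> z *v v))) (at z within H)"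
        using z H(3) by (intro has_derivative_add has_derivative_ident has_derivative_scaleR_right
            jac_has_derivative[OF diff]) auto
      show "N (a - b + h *\<^sub>R (jac f \<Omega> z *v (a - b))) \<le> (1 - h * k) * N (a - b)"
        by (rule contracting_matrixD[OF N k(2)[OF z] k(1) h])
    qed
    then show ?thesis by (simp add: algebra_simps)
  qed
  have inH: "x t 0 a \<in> H" if "a \<in> \<Omega>" "s \<le> t" for a t
  proof -
    have "x t 0 a = x s 0 (x (t - s) 0 a)"
      using solution_map_shift[OF x, of 0 "t - s" 0 s a] that \<open>s > 0\<close> by simp
    moreover have "x (t - s) 0 a \<in> \<Omega>"
      using solution_map_mem[OF x that(1), of "t - s"] that by simp
    ultimately show ?thesis unfolding H_def by (metis hull_inc imageI)
  qed
  have "N (x t 0 a - x t 0 b) \<le> exp (- k * (t - s)) * N (x s 0 a - x s 0 b)"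
    if ab: "a \<in> \<Omega>" "b \<in> \<Omega>" and "s \<le> t" for a b t
  proof (rule vector_norm_gronwall[OF N \<open>s \<le> t\<close> _ k(1)])
    fix r assume "r \<in> {s..t}"
    then show "((\<lambda>r. x r 0 a - x r 0 b) has_vector_derivative f (x r 0 a) - f (x r 0 b))
        (at r within {s..t})"
      using ab \<open>s > 0\<close> by (intro has_vector_derivative_diff solution_map_deriv[OF x]) auto
  next
    fix r h assume "r \<in> {s..t}" "0 \<le> h" "h \<le> k"
    then show "N (x r 0 a - x r 0 b + h *\<^sub>R (f (x r 0 a) - f (x r 0 b)))
        \<le> (1 + h * - k) * N (x r 0 a - x r 0 b)"
      using inH ab by (intro step) auto
  qed
  with k(1) show ?thesis by blast
qed

text \<open>The rate \<open>k\<close> after time \<open>s\<close> may degenerate as \<open>s\<close> tends to \<open>0\<close>, but its positivity alone shows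
  that distances do not grow after time \<open>s\<close>, and this survives the limit.\<close>

lemma flow_nonexpansive:
  fixes f :: "real^'n \<Rightarrow> real^'n"
  assumes "compact \<Omega>" "convex \<Omega>" and sys: "system_on f \<Omega> x"
    and leave: "\<And>a t. a \<in> frontier \<Omega> \<Longrightarrow> t > 0 \<Longrightarrow> x t 0 a \<notin> frontier \<Omega>"
    and N: "vector_norm N"
    and neg: "\<And>z. z \<in> interior \<Omega> \<Longrightarrow> matrix_measure N (jac f \<Omega> z) < 0"
    and "t > 0" and ab: "a \<in> \<Omega>" "b \<in> \<Omega>"
  shows "N (x t 0 a - x t 0 b) \<le> N (a - b)"
proof -
  have x: "solution_map f \<Omega> x" using sys by (simp add: system_on_def)
  have le: "N (x t 0 a - x t 0 b) \<le> N (x s 0 a - x s 0 b)" if s: "0 < s" "s \<le> t" for s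
  proof -
    obtain k where k: "k > 0"
      "N (x t 0 a - x t 0 b) \<le> exp (- k * (t - s)) * N (x s 0 a - x s 0 b)"
      using uniform_contraction_after[OF assms(1-6) s(1)] ab s(2) by blast
    moreover have "exp (- k * (t - s)) \<le> 1" using k(1) s by simp
    ultimately show ?thesis
      using mult_right_mono[of "exp (- k * (t - s))" 1 "N (x s 0 a - x s 0 b)"]
        vector_normD(1)[OF N] by fastforce
  qed
  have "((\<lambda>s. x s 0 c) \<longlongrightarrow> c) (at_right 0)" if "c \<in> \<Omega>" for c
    using has_vector_derivative_continuous[OF solution_map_deriv[OF x that, of 0 "{0<..}"]]
    by (simp add: continuous_within solution_map_initial[OF x that] subset_eq)
  then have "((\<lambda>s. x s 0 a - x s 0 b) \<longlongrightarrow> a - b) (at_right 0)"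
    using ab by (intro tendsto_diff)
  then have "((\<lambda>s. N (x s 0 a - x s 0 b)) \<longlongrightarrow> N (a - b)) (at_right 0)"
    using continuous_on_tendsto_compose[OF continuous_on_vector_norm[OF N, of UNIV]] by auto
  moreover have "\<forall>\<^sub>F s in at_right 0. N (x t 0 a - x t 0 b) \<le> N (x s 0 a - x s 0 b)"
    using eventually_at_right_real[OF \<open>t > 0\<close>] le by (auto elim!: eventually_mono)
  ultimately show ?thesis by (intro tendsto_lowerbound) auto
qed

theorem theorem3:
  fixes f :: "real^'n \<Rightarrow> real^'n"
    and \<Omega> :: "(real^'n) set"
    and x :: "real \<Rightarrow> real \<Rightarrow> real^'n \<Rightarrow> real^'n"
  assumes "compact \<Omega>" and "convex \<Omega>"
    and "system_on f \<Omega> x"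
    and "interior_contractive f \<Omega> x"
  shows "contraction_after_short_transient \<Omega> x"
proof -
  have x: "solution_map f \<Omega> x" using assms(3) by (simp add: system_on_def)
  have leave: "\<And>a t. a \<in> frontier \<Omega> \<Longrightarrow> t > 0 \<Longrightarrow> x t 0 a \<notin> frontier \<Omega>"
    using assms(4) unfolding interior_contractive_def by blast
  obtain N where N: "vector_norm N"
    and neg: "\<And>z. z \<in> interior \<Omega> \<Longrightarrow> matrix_measure N (jac f \<Omega> z) < 0"
    using assms(4) unfolding interior_contractive_def by blast
  show ?thesis
    unfolding contraction_after_short_transient_def
  proof (intro exI[of _ N] conjI allI impI N)
    fix \<tau> :: real assume "\<tau> > 0"
    obtain k where k: "k > 0" "\<And>a b t. a \<in> \<Omega> \<Longrightarrow> b \<in> \<Omega> \<Longrightarrow> \<tau> \<le> t \<Longrightarrow>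
      N (x t 0 a - x t 0 b) \<le> exp (- k * (t - \<tau>)) * N (x \<tau> 0 a - x \<tau> 0 b)"
      using uniform_contraction_after[OF assms(1-3) leave N neg \<open>\<tau> > 0\<close>] by blast
    have "N (x (t2 + \<tau>) t1 a - x (t2 + \<tau>) t1 b) \<le> exp (- (t2 - t1) * k) * N (a - b)"
      if t: "0 \<le> t1" "t1 \<le> t2" and ab: "a \<in> \<Omega>" "b \<in> \<Omega>" for t1 t2 a b
    proof -
      have shift: "x (t2 + \<tau>) t1 c = x (t2 - t1 + \<tau>) 0 c" if c: "c \<in> \<Omega>" for c
      proof -
        have "x t1 t1 c = c" using x t(1) c unfolding solution_map_def is_solution_def by blast
        then show ?thesis
          using solution_map_shift[OF x, of t1 t1 0 "t2 - t1 + \<tau>" c] t c \<open>\<tau> > 0\<close>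
          by (simp add: algebra_simps)
      qed
      have "N (x (t2 - t1 + \<tau>) 0 a - x (t2 - t1 + \<tau>) 0 b)
          \<le> exp (- k * (t2 - t1)) * N (x \<tau> 0 a - x \<tau> 0 b)"
        using k(2)[OF ab, of "t2 - t1 + \<tau>"] t by simp
      also have "\<dots> \<le> exp (- k * (t2 - t1)) * N (a - b)"
        using flow_nonexpansive[OF assms(1-3) leave N neg \<open>\<tau> > 0\<close> ab] by (intro mult_left_mono) auto
      also have "- k * (t2 - t1) = - (t2 - t1) * k" by (simp add: algebra_simps)
      finally show ?thesis unfolding shift[OF ab(1)] shift[OF ab(2)] .
    qed
    then show "\<exists>l>0. \<forall>t1 t2 a b. 0 \<le> t1 \<longrightarrow> t1 \<le> t2 \<longrightarrow> a \<in> \<Omega> \<longrightarrow> b \<in> \<Omega> \<longrightarrow>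
          N (x (t2 + \<tau>) t1 a - x (t2 + \<tau>) t1 b) \<le> exp (- (t2 - t1) * l) * N (a - b)"
      using k(1) by blast
  qed
qed

end
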